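(* For every partial Boolean function $g\subseteq\{0,1\}^m\times\{0,1\}$, $\bar\chi(g)\ge\mathrm{RS}(g)$.
   Context: Partial Boolean function: $g^{-1}(b)$ is the set of $x$ with $(x,b)\in g$ and $(x,1-b)\notin g$; valid inputs are $g^{-1}(0)\cup g^{-1}(1)$. Max conflict complexity: a deterministic decision tree $T$ on $\{0,1\}^m$ queries index $q(v)$ at internal node $v$, moving to $v_0$ or $v_1$; it computes $g$ if it outputs $b$ on every $x\in g^{-1}(b)$; nodes are identified with the subcubes of inputs reaching them; $d_T(v)$ is the number of vertices on the root-to-$v$ path (root has $d_T=1$); $\pi(v)$ is the parent. For distributions $\mu_0,\mu_1$ with $\mathrm{supp}(\mu_b)\subseteq g^{-1}(b)$: $p_b(v)=\Pr_{x\sim\mu_b}[x_{q(v)}=0\mid x\in v]$, $\Delta(v)=|p_0(v)-p_1(v)|$, $R(\text{root})=1$, $R(v)=R(\pi(v))\min_b\Pr_{x\sim\mu_b}[x\in v\mid x\in\pi(v)]$ (terms with $R(v)=0$ contribute $0$), $\chi(T,(\mu_0,\mu_1))=\sum_v d_T(v)\Delta(v)R(v)$. For a distribution $\mathcal Q$ over such pairs, $\chi(T,\mathcal Q)=\mathbb E_{(\mu_0,\mu_1)\sim\mathcal Q}\chi(T,(\mu_0,\mu_1))$ and $\bar\chi(g)=\max_{\mathcal Q}\min_T\chi(T,\mathcal Q)$, minimum over deterministic trees computing $g$. Sabotage complexity: let $P^*\subseteq\{0,1,*\}^m$ be the set of strings $z$ for which there exist $x\in g^{-1}(0)$ and $y\in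 g^{-1}(1)$ both agreeing with $z$ on all non-$*$ coordinates; define $P^\dagger\subseteq\{0,1,\dagger\}^m$ analogously with the symbol $\dagger$. Let $g_{\mathrm{sab}}:P^*\cup P^\dagger\to\{*,\dagger\}$ map $z\in P^*$ to $*$ and $z\in P^\dagger$ to $\dagger$. Then $\mathrm{RS}(g)=\mathrm{R}_0(g_{\mathrm{sab}})$, where $\mathrm{R}_0$ is zero-error randomized query complexity: the minimum, over randomized query algorithms that always output the correct value on every input in the domain, of the maximum over inputs of the expected number of queries. *)

theory Defs
  imports "HOL-Probability.Probability"
begin

text \<open>Inputs in \<open>A\<^sup>m\<close> are lists of length \<open>m\<close>; for bits, \<open>False\<close> is 0 and \<open>True\<close> is 1.\<close>

definition strict_preimage :: "(bool list \<times> bool) set \<Rightarrow> bool \<Rightarrow> bool list set" where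
  "strict_preimage g b = {x. (x, b) \<in> g \<and> (x, \<not> b) \<notin> g}"

datatype ('a, 'o) dtree =
  is_Leaf: Leaf 'o
| Query (index: nat) (child: "'a \<Rightarrow> ('a, 'o) dtree")

primrec valid_dtree :: "nat \<Rightarrow> ('a, 'o) dtree \<Rightarrow> bool" where
  "valid_dtree m (Leaf b) \<longleftrightarrow> True"
| "valid_dtree m (Query i k) \<longleftrightarrow> i < m \<and> (\<forall>a. valid_dtree m (k a))"

primrec run :: "('a, 'o) dtree \<Rightarrow> 'a list \<Rightarrow> 'o" where
  "run (Leaf b) x = b"
| "run (Query i k) x = run (k (x ! i)) x"

primrec num_queries :: "('a, 'o) dtree \<Rightarrow> 'a list \<Rightarrow> nat" where
  "num_queries (Leaf b) x = 0"
| "num_queries (Query i k) x = Suc (num_queries (k (x ! i)) x)"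


subsection \<open>Max conflict complexity\<close>

text \<open>
  A vertex of a tree is addressed by the list of query answers on the path from the root to it,
  so the root is \<open>[]\<close> and the parent of a non-root vertex \<open>v\<close> is \<open>butlast v\<close>.
\<close>

primrec vertices :: "('a, 'o) dtree \<Rightarrow> 'a list set" where
  "vertices (Leaf b) = {[]}"
| "vertices (Query i k) = insert [] (\<Union>a. (#) a ` vertices (k a))"

fun subtree :: "('a, 'o) dtree \<Rightarrow> 'a list \<Rightarrow> ('a, 'o) dtree" where
  "subtree T [] = T"
| "subtree (Leaf b) (a # v) = Leaf b"
| "subtree (Query i k) (a # v) = subtree (k a) v"

definition internal_vertices :: "('a, 'o) dtree \<Rightarrow> 'a list set" where
  "internal_vertices T = {v \<in> vertices T. \<not> is_Leaf (subtree T v)}"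

definition query_at :: "('a, 'o) dtree \<Rightarrow> 'a list \<Rightarrow> nat" where
  "query_at T v = index (subtree T v)"

fun reaches :: "('a, 'o) dtree \<Rightarrow> 'a list \<Rightarrow> 'a list \<Rightarrow> bool" where
  "reaches T x [] \<longleftrightarrow> True"
| "reaches (Leaf b) x (a # v) \<longleftrightarrow> False"
| "reaches (Query i k) x (a # v) \<longleftrightarrow> x ! i = a \<and> reaches (k a) x v"

definition subcube :: "nat \<Rightarrow> ('a, 'o) dtree \<Rightarrow> 'a list \<Rightarrow> 'a list set" where
  "subcube m T v = {x. length x = m \<and> reaches T x v}"

definition vertex_depth :: "'a list \<Rightarrow> nat" where
  "vertex_depth v = length v + 1"

definition computes :: "nat \<Rightarrow> (bool, bool) dtree \<Rightarrow> (bool list \<times> bool) set \<Rightarrow> bool" where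
  "computes m T g \<longleftrightarrow> valid_dtree m T \<and> (\<forall>b. \<forall>x\<in>strict_preimage g b. run T x = b)"

text \<open>
  Conditioning on an event of probability 0 gives the value 0. This only happens at vertices
  \<open>v\<close> with \<open>conflict_R m T \<mu>\<^sub>0 \<mu>\<^sub>1 v = 0\<close>, which therefore contribute 0 to \<open>conflict_chi\<close>.
\<close>

definition prob_zero :: "nat \<Rightarrow> (bool, 'o) dtree \<Rightarrow> bool list measure \<Rightarrow> bool list \<Rightarrow> real" where
  "prob_zero m T \<mu> v = \<P>(x in \<mu>. x ! query_at T v = False \<bar> x \<in> subcube m T v)"

definition conflict_Delta ::
  "nat \<Rightarrow> (bool, 'o) dtree \<Rightarrow> bool list measure \<Rightarrow> bool list measure \<Rightarrow> bool list \<Rightarrow> real" where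
  "conflict_Delta m T \<mu>\<^sub>0 \<mu>\<^sub>1 v = \<bar>prob_zero m T \<mu>\<^sub>0 v - prob_zero m T \<mu>\<^sub>1 v\<bar>"

function conflict_R ::
  "nat \<Rightarrow> (bool, 'o) dtree \<Rightarrow> bool list measure \<Rightarrow> bool list measure \<Rightarrow> bool list \<Rightarrow> real" where
  "conflict_R m T \<mu>\<^sub>0 \<mu>\<^sub>1 v =
     (if v = [] then 1
      else conflict_R m T \<mu>\<^sub>0 \<mu>\<^sub>1 (butlast v) *
        min \<P>(x in \<mu>\<^sub>0. x \<in> subcube m T v \<bar> x \<in> subcube m T (butlast v))
            \<P>(x in \<mu>\<^sub>1. x \<in> subcube m T v \<bar> x \<in> subcube m T (butlast v)))"
  by pat_completeness auto
termination
  by (relation "Wellfounded.measure (\<lambda>(m, T, \<mu>\<^sub>0, \<mu>\<^sub>1, v). length v)") auto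

declare conflict_R.simps [simp del]

definition conflict_chi ::
  "nat \<Rightarrow> (bool, 'o) dtree \<Rightarrow> bool list measure \<Rightarrow> bool list measure \<Rightarrow> real" where
  "conflict_chi m T \<mu>\<^sub>0 \<mu>\<^sub>1 =
     (\<Sum>v\<in>internal_vertices T.
        real (vertex_depth v) * conflict_Delta m T \<mu>\<^sub>0 \<mu>\<^sub>1 v * conflict_R m T \<mu>\<^sub>0 \<mu>\<^sub>1 v)"

text \<open>
  The measurable space of pairs \<open>(\<mu>\<^sub>0, \<mu>\<^sub>1)\<close> of distributions with the support of \<open>\<mu>\<^sub>b\<close> contained
  in \<open>strict_preimage g b\<close>.
\<close>

definition distribution_pairs ::
  "(bool list \<times> bool) set \<Rightarrow> (bool list measure \<times> bool list measure) measure" where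
  "distribution_pairs g =
     prob_algebra (count_space (strict_preimage g False)) \<Otimes>\<^sub>M
     prob_algebra (count_space (strict_preimage g True))"

definition conflict_chi_avg ::
  "nat \<Rightarrow> (bool, 'o) dtree \<Rightarrow> (bool list measure \<times> bool list measure) measure \<Rightarrow> ennreal" where
  "conflict_chi_avg m T Q = (\<integral>\<^sup>+ (\<mu>\<^sub>0, \<mu>\<^sub>1). ennreal (conflict_chi m T \<mu>\<^sub>0 \<mu>\<^sub>1) \<partial>Q)"

text \<open>
  If one of the two preimages is empty, there are no distributions \<open>Q\<close> and the supremum in
  \<^typ>\<open>ennreal\<close> is 0.
\<close>

definition max_conflict :: "nat \<Rightarrow> (bool list \<times> bool) set \<Rightarrow> ennreal" where
  "max_conflict m g =
     (SUP Q \<in> space (prob_algebra (distribution_pairs g)).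
        INF T \<in> {T. computes m T g}. conflict_chi_avg m T Q)"


subsection \<open>Sabotage complexity\<close>

text \<open>
  A randomized algorithm is a distribution over deterministic trees. For a finite alphabet and
  countably many outputs there are only countably many trees, so every distribution is a
  \<^type>\<open>pmf\<close>.
\<close>

definition zero_error :: "nat \<Rightarrow> ('a list \<rightharpoonup> 'o) \<Rightarrow> ('a, 'o) dtree pmf \<Rightarrow> bool" where
  "zero_error m f A \<longleftrightarrow>
     (\<forall>T\<in>set_pmf A. valid_dtree m T \<and> (\<forall>z\<in>dom f. f z = Some (run T z)))"

definition R0 :: "nat \<Rightarrow> ('a list \<rightharpoonup> 'o) \<Rightarrow> ennreal" where
  "R0 m f =
     (INF A \<in> {A. zero_error m f A}. SUP z \<in> dom f. \<integral>\<^sup>+ T. of_nat (num_queries T z) \<partial>measure_pmf A)"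

datatype symbol = Bit bool | Star | Dagger

definition sabotaged :: "nat \<Rightarrow> (bool list \<times> bool) set \<Rightarrow> symbol \<Rightarrow> symbol list set" where
  "sabotaged m g s =
     {z. length z = m \<and> set z \<subseteq> {Bit False, Bit True, s} \<and>
         (\<exists>x\<in>strict_preimage g False. \<exists>y\<in>strict_preimage g True.
            \<forall>i<m. z ! i \<noteq> s \<longrightarrow> z ! i = Bit (x ! i) \<and> z ! i = Bit (y ! i))}"

lemma sabotaged_disjoint:
  assumes "g \<subseteq> {x. length x = m} \<times> UNIV"
  shows "sabotaged m g Star \<inter> sabotaged m g Dagger = {}"
proof (rule ccontr)
  assume "sabotaged m g Star \<inter> sabotaged m g Dagger \<noteq> {}"
  then obtain z where z: "z \<in> sabotaged m g Star" "z \<in> sabotaged m g Dagger" by blast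
  then have len: "length z = m" and no: "set z \<subseteq> {Bit False, Bit True}"
    by (auto simp: sabotaged_def)
  have ns: "z ! i \<noteq> Star" if "i < m" for i
    using subsetD[OF no nth_mem, of i] len that by auto
  obtain x y where xy: "x \<in> strict_preimage g False" "y \<in> strict_preimage g True"
    "\<forall>i<m. z ! i \<noteq> Star \<longrightarrow> z ! i = Bit (x ! i) \<and> z ! i = Bit (y ! i)"
    using z(1) by (auto simp: sabotaged_def)
  have "length x = m" "length y = m"
    using xy(1,2) assms by (auto simp: strict_preimage_def)
  moreover have "x ! i = y ! i" if "i < m" for i
    using xy(3) ns[OF that] that by (metis symbol.inject)
  ultimately have "x = y" by (intro nth_equalityI) auto
  with xy(1,2) show False by (auto simp: strict_preimage_def)
qed

text \<open>By \<open>sabotaged_disjoint\<close>, the order of the cases in \<open>g_sab\<close> is irrelevant.\<close>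

definition g_sab :: "nat \<Rightarrow> (bool list \<times> bool) set \<Rightarrow> (symbol list \<rightharpoonup> symbol)" where
  "g_sab m g z =
     (if z \<in> sabotaged m g Star then Some Star
      else if z \<in> sabotaged m g Dagger then Some Dagger
      else None)"

definition RS :: "nat \<Rightarrow> (bool list \<times> bool) set \<Rightarrow> ennreal" where
  "RS m g = R0 m (g_sab m g)"

end

theory Submission
  imports Defs
begin

text \<open>
  For point masses \<open>\<mu>\<^sub>0 = \<delta>\<^sub>x\<close> and \<open>\<mu>\<^sub>1 = \<delta>\<^sub>y\<close>, the conflict \<open>\<chi>(T, (\<mu>\<^sub>0, \<mu>\<^sub>1))\<close> is the number of queries after
  which \<open>T\<close> separates \<open>x\<close> from \<open>y\<close>. That is also the number of queries after which \<open>T\<close> hits a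
  sabotaged coordinate of the string that agrees with \<open>x\<close> and \<open>y\<close> wherever they coincide and is
  sabotaged elsewhere. Hence a distribution over trees computing \<open>g\<close> solves the sabotage problem at
  a cost bounded by its worst expected separation time, and the minimax theorem turns the best such
  distribution into a hard distribution over pairs \<open>(\<delta>\<^sub>x, \<delta>\<^sub>y)\<close>.
\<close>

section \<open>A minimax theorem with one finite side\<close>

text \<open>
  The weights come from an almost-minimiser \<open>c\<close> of the squared distance
  \<open>\<Sum>\<^sub>i max(0, c\<^sub>i - V)\<^sup>2\<close> to the orthant \<open>{c. \<forall>i. c\<^sub>i \<le> V}\<close>: they are proportional to \<open>max(0, c\<^sub>i - V)\<close>.
\<close>

lemma minimax_weights_bounded:
  fixes C :: "('i \<Rightarrow> real) set" and V \<epsilon> K :: real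
  assumes fin: "finite I" and ne: "C \<noteq> {}"
    and conv: "\<And>c d t. c \<in> C \<Longrightarrow> d \<in> C \<Longrightarrow> 0 \<le> t \<Longrightarrow> t \<le> 1 \<Longrightarrow> (\<lambda>i. (1 - t) * c i + t * d i) \<in> C"
    and bounded: "\<And>c i. c \<in> C \<Longrightarrow> i \<in> I \<Longrightarrow> 0 \<le> c i \<and> c i \<le> K"
    and eps: "\<epsilon> > 0" and large: "\<And>c. c \<in> C \<Longrightarrow> \<exists>i\<in>I. V + \<epsilon> \<le> c i"
  shows "\<exists>q. (\<forall>i\<in>I. 0 \<le> q i) \<and> sum q I = 1 \<and> (\<forall>d\<in>C. V \<le> (\<Sum>i\<in>I. q i * d i))"
proof -
  define \<phi> where "\<phi> c = (\<Sum>i\<in>I. (max 0 (c i - V))\<^sup>2)" for c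
  define \<delta> where "\<delta> = (INF c\<in>C. \<phi> c)"
  \<comment> \<open>\<open>B\<close> is positive and bounds the squared distance over
    \<open>I\<close> between two points of \<open>C\<close>. The choice of \<open>t\<close> then
    keeps the second-order term \<open>t\<^sup>2 * B\<close> below
    \<open>t * \<delta>\<close>.\<close>
  define B where "B = real (card I) * K\<^sup>2 + 1"
  define t where "t = min 1 (\<delta> / B)"
  \<comment> \<open>The margin \<open>\<epsilon>\<close> keeps \<open>C\<close> away from the
    orthant, so \<open>\<delta>\<close> and hence \<open>t\<close> are positive.\<close>
  have phi_ge: "\<epsilon>\<^sup>2 \<le> \<phi> c" if c: "c \<in> C" for c
  proof -
    obtain i where i: "i \<in> I" "V + \<epsilon> \<le> c i" using large[OF c] by blast
    have "\<epsilon>\<^sup>2 \<le> (max 0 (c i - V))\<^sup>2" using i eps by (intro power_mono) auto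
    also have "\<dots> \<le> \<phi> c" unfolding \<phi>_def using i fin by (intro member_le_sum) auto
    finally show ?thesis .
  qed
  have bdd: "bdd_below (\<phi> ` C)" using phi_ge by (intro bdd_belowI2[of _ "\<epsilon>\<^sup>2"]) auto
  have "\<epsilon>\<^sup>2 \<le> \<delta>" unfolding \<delta>_def using ne phi_ge by (intro cINF_greatest) auto
  with eps have delta: "\<delta> > 0" by (smt (verit) zero_less_power)
  have delta_le: "\<delta> \<le> \<phi> c" if "c \<in> C" for c unfolding \<delta>_def using bdd that by (intro cINF_lower) auto
  have B: "B \<ge> 1" unfolding B_def by simp
  have t: "0 < t" "t \<le> 1" "t * B \<le> \<delta>" unfolding t_def using delta B
    by (auto simp: min_def field_simps)
  \<comment> \<open>The infimum need not be attained; an excess of \<open>t * \<delta>\<close> is no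
    larger than the allowance for the second-order term.\<close>
  have "\<exists>c\<in>C. \<phi> c < \<delta> + t * \<delta>"
    unfolding \<delta>_def using cInf_lessD[of "\<phi> ` C" "\<delta> + t * \<delta>"] ne delta t by (auto simp: \<delta>_def)
  then obtain c where c: "c \<in> C" "\<phi> c < \<delta> + t * \<delta>" by blast
  define w where "w i = max 0 (c i - V)" for i
  have key: "V * sum w I \<le> (\<Sum>i\<in>I. w i * d i)" if d: "d \<in> C" for d
  proof -
    have sq: "(\<Sum>i\<in>I. (d i - c i)\<^sup>2) \<le> B"
    proof -
      have "(\<Sum>i\<in>I. (d i - c i)\<^sup>2) \<le> (\<Sum>i\<in>I. K\<^sup>2)"
      proof (intro sum_mono)
        fix i assume "i \<in> I"
        with bounded[OF d this] bounded[OF c(1) this] have "\<bar>d i - c i\<bar> \<le> \<bar>K\<bar>" by auto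
        then show "(d i - c i)\<^sup>2 \<le> K\<^sup>2" by (simp add: abs_le_square_iff)
      qed
      then show ?thesis unfolding B_def by simp
    qed
    \<comment> \<open>First-order optimality: a step \<open>t\<close> from \<open>c\<close> towards
      \<open>d\<close> cannot bring \<open>\<phi>\<close> below \<open>\<delta>\<close>, so the
      derivative of \<open>\<phi>\<close> at \<open>c\<close> in the direction \<open>d - c\<close>,
      twice the inner product with \<open>w\<close>, is almost nonnegative.\<close>
    have "\<delta> \<le> \<phi> (\<lambda>i. (1 - t) * c i + t * d i)"
      using conv[OF c(1) d] t by (intro delta_le) auto
    also have "\<dots> \<le> (\<Sum>i\<in>I. (w i)\<^sup>2 + 2 * t * (w i * d i - w i * c i) + t\<^sup>2 * (d i - c i)\<^sup>2)"
      unfolding \<phi>_def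
    proof (intro sum_mono)
      fix i assume "i \<in> I"
      have "max 0 ((1 - t) * c i + t * d i - V) \<le> \<bar>w i + t * (d i - c i)\<bar>"
      proof -
        have "(1 - t) * c i + t * d i - V = (c i - V) + t * (d i - c i)" by (simp add: algebra_simps)
        then show ?thesis unfolding w_def by simp
      qed
      then have "(max 0 ((1 - t) * c i + t * d i - V))\<^sup>2 \<le> \<bar>w i + t * (d i - c i)\<bar>\<^sup>2"
        by (intro power_mono) auto
      then show "(max 0 ((1 - t) * c i + t * d i - V))\<^sup>2
          \<le> (w i)\<^sup>2 + 2 * t * (w i * d i - w i * c i) + t\<^sup>2 * (d i - c i)\<^sup>2"
        by (simp add: power2_eq_square algebra_simps)
    qed
    also have "\<dots> = \<phi> c + 2 * t * ((\<Sum>i\<in>I. w i * d i) - (\<Sum>i\<in>I. w i * c i))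
        + t\<^sup>2 * (\<Sum>i\<in>I. (d i - c i)\<^sup>2)"
      unfolding \<phi>_def w_def by (simp add: sum.distrib sum_distrib_left[symmetric] sum_subtractf)
    also have "\<dots> \<le> (\<delta> + t * \<delta>) + 2 * t * ((\<Sum>i\<in>I. w i * d i) - (\<Sum>i\<in>I. w i * c i)) + t * \<delta>"
    proof -
      have "t\<^sup>2 * (\<Sum>i\<in>I. (d i - c i)\<^sup>2) \<le> t\<^sup>2 * B" using sq by (intro mult_left_mono) auto
      also have "\<dots> = t * (t * B)" by (simp add: power2_eq_square)
      also have "\<dots> \<le> t * \<delta>" using t by (intro mult_left_mono) auto
      finally show ?thesis using c(2) by linarith
    qed
    finally have "0 \<le> 2 * t * (\<delta> + (\<Sum>i\<in>I. w i * d i) - (\<Sum>i\<in>I. w i * c i))"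
      by (simp add: algebra_simps)
    then have "(\<Sum>i\<in>I. w i * c i) - \<delta> \<le> (\<Sum>i\<in>I. w i * d i)"
      using t(1) by (simp add: zero_le_mult_iff)
    \<comment> \<open>Where \<open>w i\<close> is nonzero, \<open>c i = V + w i\<close>. The
      resulting surplus \<open>\<phi> c\<close> absorbs the loss \<open>\<delta>\<close>.\<close>
    moreover have "(\<Sum>i\<in>I. w i * c i) = V * sum w I + \<phi> c"
      unfolding \<phi>_def w_def sum_distrib_left sum.distrib[symmetric]
      by (intro sum.cong refl) (simp add: max_def power2_eq_square algebra_simps)
    ultimately show ?thesis using delta_le[OF c(1)] by simp
  qed
  have "sum w I > 0"
  proof -
    obtain i where i: "i \<in> I" "V + \<epsilon> \<le> c i" using large[OF c(1)] by blast
    have "0 < w i" using i eps by (auto simp: w_def)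
    then show ?thesis using i fin by (intro sum_pos2[of I i]) (auto simp: w_def)
  qed
  then have "(\<forall>i\<in>I. 0 \<le> w i / sum w I) \<and> (\<Sum>i\<in>I. w i / sum w I) = 1 \<and>
      (\<forall>d\<in>C. V \<le> (\<Sum>i\<in>I. w i / sum w I * d i))"
    using key by (simp add: sum_divide_distrib[symmetric] pos_le_divide_eq w_def)
  then show ?thesis by (rule exI[where x = "\<lambda>i. w i / sum w I"])
qed

text \<open>Payoffs may be unbounded over \<open>S\<close>, so
  \<open>minimax_weights_bounded\<close> is applied to the members with payoffs at most a constant.
  The gap between \<open>V'\<close> and \<open>V\<close> supplies both the margin of that lemma and
  the weight set aside against large payoffs.\<close>

lemma minimax_weights:
  fixes f :: "'a \<Rightarrow> 'i \<Rightarrow> real" and V V' :: real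
  assumes fin: "finite I" and ne: "I \<noteq> {}" and nonneg: "\<And>T i. 0 \<le> f T i"
    and large: "\<And>A. set_pmf A \<subseteq> S \<Longrightarrow> \<exists>i\<in>I. ennreal V \<le> (\<integral>\<^sup>+T. ennreal (f T i) \<partial>measure_pmf A)"
    and V: "V' < V"
  shows "\<exists>q. (\<forall>i\<in>I. 0 \<le> q i) \<and> sum q I = 1 \<and> (\<forall>T\<in>S. V' \<le> (\<Sum>i\<in>I. q i * f T i))"
proof -
  define n where "n = real (card I)"
  have n: "n > 0" using fin ne by (simp add: n_def card_gt_0_iff)
  have uniform: "(\<Sum>i\<in>I. 1 / n) = 1" using n by (simp add: n_def)
  show ?thesis
  proof (cases "V' > 0")
    case False
    have "0 \<le> (\<Sum>i\<in>I. 1 / n * f T i)" for T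
      using n nonneg by (intro sum_nonneg) simp
    then have "V' \<le> (\<Sum>i\<in>I. 1 / n * f T i)" for T
      using False by (meson not_less order_trans)
    then show ?thesis using n uniform by (intro exI[of _ "\<lambda>i. 1 / n"]) simp
  next
    case True
    \<comment> \<open>The constants solve \<open>(1 - l) * W = V'\<close> and
      \<open>l / n * K = V'\<close>: weights good for \<open>W\<close> may be scaled by
      \<open>1 - l\<close>, and a share \<open>l / n\<close> on a single payoff above
      \<open>K\<close> already yields \<open>V'\<close>.\<close>
    define W where "W = (V + V') / 2"
    have W: "V' < W" "W < V" "W > 0" using V True by (auto simp: W_def)
    define l where "l = 1 - V' / W"
    have l: "0 < l" "l < 1" using W True by (auto simp: l_def)
    define K where "K = n * V' / l"
    have K0: "K > 0" using n l True by (simp add: K_def)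
    define SK where "SK = {T\<in>S. \<forall>i\<in>I. f T i \<le> K}"
    \<comment> \<open>These are the vectors of expected payoffs, unconstrained outside
      \<open>I\<close>. The condition \<open>0 \<le> c i\<close> is stated because
      \<open>ennreal\<close> sends negative reals to 0.\<close>
    define C where "C = {c. \<exists>A. set_pmf A \<subseteq> SK \<and>
      (\<forall>i\<in>I. 0 \<le> c i \<and> ennreal (c i) = (\<integral>\<^sup>+T. ennreal (f T i) \<partial>measure_pmf A))}"
    have in_C: "f T \<in> C" if "T \<in> SK" for T
      unfolding C_def using that nonneg by (auto intro!: exI[of _ "return_pmf T"])
    obtain q where q: "\<And>i. i \<in> I \<Longrightarrow> 0 \<le> q i" "sum q I = 1"
      "\<And>T. T \<in> SK \<Longrightarrow> W \<le> (\<Sum>i\<in>I. q i * f T i)"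
    proof (cases "SK = {}")
      case True
      then show ?thesis using n uniform by (intro that[of "\<lambda>i. 1 / n"]) simp_all
    next
      case False
      have "\<exists>q. (\<forall>i\<in>I. 0 \<le> q i) \<and> sum q I = 1 \<and> (\<forall>d\<in>C. W \<le> (\<Sum>i\<in>I. q i * d i))"
      proof (rule minimax_weights_bounded[where \<epsilon> = "V - W" and K = K, OF fin])
        show "C \<noteq> {}" using in_C False by auto
        show "V - W > 0" using W by simp
      next
        fix c d :: "'i \<Rightarrow> real" and t :: real
        assume "c \<in> C" "d \<in> C" and t: "0 \<le> t" "t \<le> 1"
        then obtain A D where A: "set_pmf A \<subseteq> SK"
            "\<And>i. i \<in> I \<Longrightarrow> 0 \<le> c i \<and> ennreal (c i) = (\<integral>\<^sup>+T. ennreal (f T i) \<partial>measure_pmf A)"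
          and D: "set_pmf D \<subseteq> SK"
            "\<And>i. i \<in> I \<Longrightarrow> 0 \<le> d i \<and> ennreal (d i) = (\<integral>\<^sup>+T. ennreal (f T i) \<partial>measure_pmf D)"
          unfolding C_def by blast
        define E where "E = bind_pmf (bernoulli_pmf t) (\<lambda>b. if b then D else A)"
        have "set_pmf E \<subseteq> SK" using A(1) D(1) by (auto simp: E_def split: if_splits)
        moreover have "0 \<le> (1 - t) * c i + t * d i \<and> ennreal ((1 - t) * c i + t * d i)
            = (\<integral>\<^sup>+T. ennreal (f T i) \<partial>measure_pmf E)" if i: "i \<in> I" for i
        proof -
          have "(\<integral>\<^sup>+T. ennreal (f T i) \<partial>measure_pmf E) = ennreal (d i) * ennreal t + ennreal (c i) * ennreal (1 - t)"
            using A(2)[OF i] D(2)[OF i] t by (simp add: E_def)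
          also have "\<dots> = ennreal ((1 - t) * c i + t * d i)"
            using A(2)[OF i, THEN conjunct1] D(2)[OF i, THEN conjunct1] t
            by (simp add: ennreal_mult ennreal_plus mult.commute add.commute)
          finally show ?thesis using A(2)[OF i] D(2)[OF i] t by simp
        qed
        ultimately show "(\<lambda>i. (1 - t) * c i + t * d i) \<in> C" unfolding C_def by blast
      next
        fix c i assume "c \<in> C" and i: "i \<in> I"
        then obtain A where A: "set_pmf A \<subseteq> SK" "0 \<le> c i"
            "ennreal (c i) = (\<integral>\<^sup>+T. ennreal (f T i) \<partial>measure_pmf A)"
          unfolding C_def by blast
        have "f T i \<le> K" if "T \<in> set_pmf A" for T using A(1) i that unfolding SK_def by blast
        then have "(\<integral>\<^sup>+T. ennreal (f T i) \<partial>measure_pmf A) \<le> (\<integral>\<^sup>+T. ennreal K \<partial>measure_pmf A)"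
          by (intro nn_integral_mono_AE) (simp add: AE_measure_pmf_iff ennreal_leI)
        then have "ennreal (c i) \<le> ennreal K" using A(3) by simp
        then show "0 \<le> c i \<and> c i \<le> K" using A(2) K0 by (simp add: ennreal_le_iff)
      next
        fix c assume "c \<in> C"
        then obtain A where A: "set_pmf A \<subseteq> SK"
            "\<And>i. i \<in> I \<Longrightarrow> 0 \<le> c i \<and> ennreal (c i) = (\<integral>\<^sup>+T. ennreal (f T i) \<partial>measure_pmf A)"
          unfolding C_def by blast
        obtain i where i: "i \<in> I" "ennreal V \<le> (\<integral>\<^sup>+T. ennreal (f T i) \<partial>measure_pmf A)"
          using large[of A] A(1) by (auto simp: SK_def)
        then have "ennreal V \<le> ennreal (c i)" using A(2) by simp
        then have "V \<le> c i" using A(2)[OF i(1), THEN conjunct1] by (simp add: ennreal_le_iff)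
        then show "\<exists>i\<in>I. W + (V - W) \<le> c i" using i(1) by auto
      qed
      then show ?thesis using that in_C by blast
    qed
    \<comment> \<open>Mixing in a little of the uniform distribution takes care of the unbounded payoffs.\<close>
    define q' where "q' i = (1 - l) * q i + l / n" for i
    have "0 \<le> q' i" if "i \<in> I" for i using q(1)[OF that] l n by (simp add: q'_def)
    moreover have "sum q' I = 1"
      using n q(2) by (simp add: q'_def sum.distrib sum_distrib_left[symmetric] n_def[symmetric])
    moreover have "V' \<le> (\<Sum>i\<in>I. q' i * f T i)" if T: "T \<in> S" for T
    proof (cases "T \<in> SK")
      case True
      have "V' = (1 - l) * W" using W by (simp add: l_def)
      also have "\<dots> \<le> (1 - l) * (\<Sum>i\<in>I. q i * f T i)" using q(3)[OF True] l by (intro mult_left_mono) auto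
      also have "\<dots> \<le> (\<Sum>i\<in>I. q' i * f T i)"
        unfolding sum_distrib_left q'_def using l n nonneg
        by (intro sum_mono) (auto simp: algebra_simps)
      finally show ?thesis .
    next
      case False
      then obtain i where i: "i \<in> I" "K < f T i" using T by (auto simp: SK_def not_le)
      have "V' = l / n * K" using l n by (simp add: K_def)
      also have "\<dots> \<le> q' i * f T i"
        using i l n K0 q(1)[OF i(1)] by (intro mult_mono) (auto simp: q'_def)
      also have "\<dots> \<le> (\<Sum>i\<in>I. q' i * f T i)"
        using i fin nonneg \<open>\<And>i. i \<in> I \<Longrightarrow> 0 \<le> q' i\<close> by (intro member_le_sum) auto
      finally show ?thesis .
    qed
    ultimately show ?thesis by blast
  qed
qed

section \<open>Separating two inputs\<close>

text \<open>The separating query is counted, in line with \<open>vertex_depth\<close> being 1 at the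
  root. If both inputs reach the same leaf, all queries on their path are counted.\<close>

primrec separation_time :: "('a, 'o) dtree \<Rightarrow> 'a list \<Rightarrow> 'a list \<Rightarrow> nat" where
  "separation_time (Leaf b) x y = 0"
| "separation_time (Query i k) x y =
     (if x ! i = y ! i then Suc (separation_time (k (x ! i)) x y) else 1)"

text \<open>Different outputs mean different leaves, so the two paths part at some internal
  vertex.\<close>

lemma separating_vertex:
  assumes "run T x \<noteq> run T y"
  shows "\<exists>v\<in>internal_vertices T. vertex_depth v = separation_time T x y \<and>
    reaches T x v \<and> reaches T y v \<and> x ! query_at T v \<noteq> y ! query_at T v"
  using assms
proof (induction T)
  case (Leaf b)
  then show ?case by simp
next
  case (Query i k)
  show ?case
  proof (cases "x ! i = y ! i")
    case False
    then show ?thesis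
      by (intro bexI[of _ "[]"]) (auto simp: internal_vertices_def vertex_depth_def query_at_def)
  next
    case True
    then obtain v where "v \<in> internal_vertices (k (x ! i))"
      "vertex_depth v = separation_time (k (x ! i)) x y" "reaches (k (x ! i)) x v"
      "reaches (k (x ! i)) y v" "x ! query_at (k (x ! i)) v \<noteq> y ! query_at (k (x ! i)) v"
      using Query.IH[of "k (x ! i)"] Query.prems by auto
    with True show ?thesis
      by (intro bexI[of _ "(x ! i) # v"]) (auto simp: internal_vertices_def vertex_depth_def query_at_def)
  qed
qed

lemma finite_vertices: "finite (vertices (T :: ('a::finite, 'o) dtree))"
  by (induction T) auto

lemma reaches_butlast: "reaches T x v \<Longrightarrow> reaches T x (butlast v)"
  by (induction T x v rule: reaches.induct) auto

lemma cond_prob_return: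
  assumes "x \<in> S" "Q x"
  shows "\<P>(x in return (count_space S) x. P x \<bar> Q x) = (if P x then 1 else 0)"
  using assms by (simp add: cond_prob_def measure_return indicator_def)

lemma conflict_R_nonneg: "0 \<le> conflict_R m T \<mu>\<^sub>0 \<mu>\<^sub>1 v"
  by (induction m T \<mu>\<^sub>0 \<mu>\<^sub>1 v rule: conflict_R.induct)
     (subst conflict_R.simps, simp add: cond_prob_def)

lemma conflict_R_Nil: "conflict_R m T \<mu>\<^sub>0 \<mu>\<^sub>1 [] = 1"
  by (subst conflict_R.simps) simp

text \<open>Along the common path of \<open>x\<close> and \<open>y\<close>, each point mass moves to
  the next vertex with conditional probability 1, so every factor of the recursion is 1.\<close>

lemma conflict_R_return:
  assumes "x \<in> S\<^sub>0" "y \<in> S\<^sub>1" "length x = m" "length y = m" "reaches T x v" "reaches T y v"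
  shows "conflict_R m T (return (count_space S\<^sub>0) x) (return (count_space S\<^sub>1) y) v = 1"
  using assms(5,6)
proof (induction "length v" arbitrary: v)
  case 0
  then show ?case by (simp add: conflict_R_Nil)
next
  case (Suc n)
  have R: "reaches T x (butlast v)" "reaches T y (butlast v)"
    using Suc.prems reaches_butlast by auto
  have "conflict_R m T (return (count_space S\<^sub>0) x) (return (count_space S\<^sub>1) y) (butlast v) = 1"
    using Suc.hyps R by simp
  moreover have "v \<noteq> []" using Suc.hyps by auto
  ultimately show ?case
    using Suc.prems R assms by (subst conflict_R.simps) (simp add: cond_prob_return subcube_def)
qed

text \<open>At the vertex where the paths part, \<open>conflict_Delta\<close> and
  \<open>conflict_R\<close> are both 1, so its term is its depth. The other terms are nonnegative,
  which is enough for a lower bound.\<close>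

lemma separation_time_le_conflict_chi:
  assumes "x \<in> S\<^sub>0" "y \<in> S\<^sub>1" "length x = m" "length y = m" "run T x \<noteq> run T y"
  shows "real (separation_time T x y)
    \<le> conflict_chi m T (return (count_space S\<^sub>0) x) (return (count_space S\<^sub>1) y)"
proof -
  let ?\<mu>\<^sub>0 = "return (count_space S\<^sub>0) x" and ?\<mu>\<^sub>1 = "return (count_space S\<^sub>1) y"
  let ?t = "\<lambda>v. real (vertex_depth v) * conflict_Delta m T ?\<mu>\<^sub>0 ?\<mu>\<^sub>1 v * conflict_R m T ?\<mu>\<^sub>0 ?\<mu>\<^sub>1 v"
  obtain v where v: "v \<in> internal_vertices T" "vertex_depth v = separation_time T x y"
    "reaches T x v" "reaches T y v" "x ! query_at T v \<noteq> y ! query_at T v"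
    using separating_vertex[OF assms(5)] by blast
  have "conflict_Delta m T ?\<mu>\<^sub>0 ?\<mu>\<^sub>1 v = 1"
    using v assms by (auto simp: conflict_Delta_def prob_zero_def cond_prob_return subcube_def)
  then have "real (separation_time T x y) = ?t v"
    using v conflict_R_return[OF assms(1-4) v(3,4)] by simp
  also have "\<dots> \<le> (\<Sum>v\<in>internal_vertices T. ?t v)"
    using v(1) finite_vertices[of T]
    by (intro member_le_sum) (auto simp: internal_vertices_def conflict_Delta_def conflict_R_nonneg)
  finally show ?thesis by (simp add: conflict_chi_def)
qed

section \<open>Lower bound on the max conflict complexity\<close>

text \<open>A conditional probability is a quotient of the measures of two fixed events, and the
  measure of a fixed event depends measurably on the distribution.\<close>

lemma measurable_cond_prob_prob_algebra:
  "(\<lambda>\<mu>. \<P>(x in \<mu>. P x \<bar> Q x)) \<in> borel_measurable (prob_algebra (count_space S))"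
proof -
  have "(\<lambda>\<mu>. measure \<mu> {x\<in>S. P x \<and> Q x} / measure \<mu> {x\<in>S. Q x})
      \<in> borel_measurable (prob_algebra (count_space S))"
    by (intro borel_measurable_divide measurable_measure_prob_algebra) auto
  also have "?this \<longleftrightarrow> ?thesis"
  proof (intro measurable_cong)
    fix \<mu> assume "\<mu> \<in> space (prob_algebra (count_space S))"
    then have "space \<mu> = S" using sets_eq_imp_space_eq[of \<mu> "count_space S"] by (simp add: space_prob_algebra)
    then show "measure \<mu> {x\<in>S. P x \<and> Q x} / measure \<mu> {x\<in>S. Q x} = \<P>(x in \<mu>. P x \<bar> Q x)"
      by (simp add: cond_prob_def)
  qed
  finally show ?thesis .
qed

text \<open>This allows the integral over a push-forward in \<open>conflict_chi_avg\<close> to be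
  pulled back to pairs of inputs.\<close>

lemma measurable_conflict_chi:
  "(\<lambda>(\<mu>\<^sub>0, \<mu>\<^sub>1). conflict_chi m T \<mu>\<^sub>0 \<mu>\<^sub>1) \<in> borel_measurable (distribution_pairs g)"
proof -
  have fst: "(\<lambda>p. \<P>(x in fst p. P x \<bar> Q x)) \<in> borel_measurable (distribution_pairs g)" for P Q
    unfolding distribution_pairs_def
    by (rule measurable_compose[OF measurable_fst measurable_cond_prob_prob_algebra])
  have snd: "(\<lambda>p. \<P>(x in snd p. P x \<bar> Q x)) \<in> borel_measurable (distribution_pairs g)" for P Q
    unfolding distribution_pairs_def
    by (rule measurable_compose[OF measurable_snd measurable_cond_prob_prob_algebra])
  have R: "(\<lambda>p. conflict_R m T (fst p) (snd p) v) \<in> borel_measurable (distribution_pairs g)" for v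
  proof (induction "length v" arbitrary: v)
    case 0
    then show ?case by (simp add: conflict_R_Nil)
  next
    case (Suc n)
    then have "v \<noteq> []" by auto
    then show ?case
      using Suc
      by (subst conflict_R.simps) (simp, intro borel_measurable_times borel_measurable_min fst snd, auto)
  qed
  show ?thesis
    unfolding conflict_chi_def conflict_Delta_def prob_zero_def case_prod_beta
    by (intro borel_measurable_sum borel_measurable_times borel_measurable_abs
        borel_measurable_diff borel_measurable_const fst snd R)
qed

text \<open>The weights \<open>q\<close>, pushed forward along the map from \<open>(x, y)\<close> to
  the pair of point masses, form one admissible \<open>Q\<close> in the supremum.\<close>

lemma max_conflict_ge_weighted_separation:
  fixes q :: "bool list \<times> bool list \<Rightarrow> real" and V :: real
  assumes dom: "g \<subseteq> {x. length x = m} \<times> UNIV"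
    and I: "I = strict_preimage g False \<times> strict_preimage g True" and fin: "finite I"
    and q: "\<And>i. i \<in> I \<Longrightarrow> 0 \<le> q i" "sum q I = 1"
    and V: "\<And>T. computes m T g \<Longrightarrow> V \<le> (\<Sum>(x, y)\<in>I. q (x, y) * real (separation_time T x y))"
  shows "ennreal V \<le> max_conflict m g"
proof -
  let ?S = "strict_preimage g"
  define M where "M = point_measure I (\<lambda>i. ennreal (q i))"
  define h where "h = (\<lambda>(x, y). (return (count_space (?S False)) x, return (count_space (?S True)) y))"
  define Q where "Q = distr M (distribution_pairs g) h"
  have "sum (\<lambda>i. ennreal (q i)) I = 1" using q by (subst sum_ennreal) auto
  then have M: "prob_space M" unfolding M_def using fin by (intro prob_space_point_measure) auto
  \<comment> \<open>Every subset of \<open>I\<close> is measurable in \<open>M\<close>, so it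
    suffices that \<open>h\<close> takes values in the target space.\<close>
  have h: "h \<in> measurable M (distribution_pairs g)"
    unfolding M_def I h_def distribution_pairs_def
    by (auto simp: space_pair_measure space_prob_algebra intro!: prob_space_return)
  have Q: "Q \<in> space (prob_algebra (distribution_pairs g))"
    unfolding Q_def space_prob_algebra using prob_space.prob_space_distr[OF M h] by simp
  have "ennreal V \<le> conflict_chi_avg m T Q" if T: "computes m T g" for T
  proof -
    have "ennreal V \<le> ennreal (\<Sum>(x, y)\<in>I. q (x, y) * real (separation_time T x y))"
      using V[OF T] by (rule ennreal_leI)
    also have "\<dots> \<le> ennreal (\<Sum>i\<in>I. q i * (case h i of (\<mu>\<^sub>0, \<mu>\<^sub>1) \<Rightarrow> conflict_chi m T \<mu>\<^sub>0 \<mu>\<^sub>1))"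
    proof (intro ennreal_leI sum_mono, clarify)
      fix x y assume xy: "(x, y) \<in> I"
      then have "run T x = False" "run T y = True" using T by (auto simp: I computes_def)
      moreover have "length x = m" "length y = m"
        using xy dom by (auto simp: I strict_preimage_def)
      ultimately have "real (separation_time T x y) \<le> (case h (x, y) of (\<mu>\<^sub>0, \<mu>\<^sub>1) \<Rightarrow> conflict_chi m T \<mu>\<^sub>0 \<mu>\<^sub>1)"
        using xy by (auto simp: h_def I intro!: separation_time_le_conflict_chi)
      then show "q (x, y) * real (separation_time T x y)
          \<le> q (x, y) * (case h (x, y) of (\<mu>\<^sub>0, \<mu>\<^sub>1) \<Rightarrow> conflict_chi m T \<mu>\<^sub>0 \<mu>\<^sub>1)"
        using q(1)[OF xy] by (rule mult_left_mono)
    qed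
    also have "\<dots> = (\<Sum>i\<in>I. ennreal (q i) * ennreal (case h i of (\<mu>\<^sub>0, \<mu>\<^sub>1) \<Rightarrow> conflict_chi m T \<mu>\<^sub>0 \<mu>\<^sub>1))"
    proof -
      have nn: "0 \<le> (case h i of (\<mu>\<^sub>0, \<mu>\<^sub>1) \<Rightarrow> conflict_chi m T \<mu>\<^sub>0 \<mu>\<^sub>1)" for i
        by (cases "h i") (auto simp: conflict_chi_def conflict_Delta_def intro!: sum_nonneg mult_nonneg_nonneg conflict_R_nonneg)
      then show ?thesis
        using q(1) by (subst sum_ennreal[symmetric]) (auto simp: ennreal_mult nn intro!: sum.cong mult_nonneg_nonneg)
    qed
    also have "\<dots> = (\<integral>\<^sup>+i. ennreal (case h i of (\<mu>\<^sub>0, \<mu>\<^sub>1) \<Rightarrow> conflict_chi m T \<mu>\<^sub>0 \<mu>\<^sub>1) \<partial>M)"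
      unfolding M_def using fin by (subst nn_integral_point_measure_finite) auto
    also have "\<dots> = conflict_chi_avg m T Q"
      unfolding conflict_chi_avg_def Q_def
      using measurable_compose[OF measurable_conflict_chi measurable_ennreal]
      by (subst nn_integral_distr[OF h]) (simp_all add: case_prod_unfold)
    finally show ?thesis .
  qed
  then have "ennreal V \<le> (INF T \<in> {T. computes m T g}. conflict_chi_avg m T Q)"
    by (intro INF_greatest) auto
  also have "\<dots> \<le> max_conflict m g" unfolding max_conflict_def using Q by (intro SUP_upper)
  finally show ?thesis .
qed

section \<open>Sabotage from separation\<close>

text \<open>The output at a former leaf of \<open>T\<close> is a dummy: when \<open>T\<close>
  computes \<open>g\<close>, no sabotaged input gets there.\<close>

primrec sabotage_tree :: "(bool, bool) dtree \<Rightarrow> (symbol, symbol) dtree" where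
  "sabotage_tree (Leaf b) = Leaf Star"
| "sabotage_tree (Query i k) =
     Query i (\<lambda>s. case s of Bit b \<Rightarrow> sabotage_tree (k b) | Star \<Rightarrow> Leaf Star | Dagger \<Rightarrow> Leaf Dagger)"

lemma valid_sabotage_tree: "valid_dtree m T \<Longrightarrow> valid_dtree m (sabotage_tree T)"
  by (induction T) (auto split: symbol.splits)

text \<open>Until a sabotaged coordinate is queried, \<open>z\<close> follows the common path of
  \<open>x\<close> and \<open>y\<close>. These must part, and they can only do so at a sabotaged
  coordinate. The bound is an inequality because \<open>z\<close> may also be sabotaged where
  \<open>x\<close> and \<open>y\<close> agree.\<close>

lemma sabotage_tree_correct:
  assumes "valid_dtree m T" "run T x \<noteq> run T y" "s \<in> {Star, Dagger}"
    and "\<forall>i<m. z ! i \<noteq> s \<longrightarrow> z ! i = Bit (x ! i) \<and> z ! i = Bit (y ! i)"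
  shows "run (sabotage_tree T) z = s \<and> num_queries (sabotage_tree T) z \<le> separation_time T x y"
  using assms(1,2)
proof (induction T)
  case (Leaf b)
  then show ?case by simp
next
  case (Query i k)
  show ?case
  proof (cases "z ! i = s")
    case True
    then show ?thesis using assms(3) by auto
  next
    case False
    then have z: "z ! i = Bit (x ! i)" and xy: "x ! i = y ! i"
      using assms(4) Query.prems(1) by (metis symbol.inject valid_dtree.simps(2))+
    then show ?thesis
      using Query.IH[of "k (x ! i)"] Query.prems by auto
  qed
qed

lemma RS_le_separation:
  assumes A: "\<And>T. T \<in> set_pmf A \<Longrightarrow> computes m T g"
  shows "RS m g \<le> (SUP (x, y) \<in> strict_preimage g False \<times> strict_preimage g True.
    \<integral>\<^sup>+T. of_nat (separation_time T x y) \<partial>measure_pmf A)"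
proof -
  define B where "B = map_pmf sabotage_tree A"
  \<comment> \<open>The witnesses \<open>x\<close> and \<open>y\<close> depend on \<open>z\<close>
    but not on \<open>T\<close>, so the pointwise bound can be averaged over
    \<open>A\<close>.\<close>
  have sab: "\<exists>s x y. g_sab m g z = Some s \<and> x \<in> strict_preimage g False \<and> y \<in> strict_preimage g True \<and>
      (\<forall>T\<in>set_pmf A. run (sabotage_tree T) z = s \<and> num_queries (sabotage_tree T) z \<le> separation_time T x y)"
    if z: "z \<in> Map.dom (g_sab m g)" for z
  proof -
    obtain s where s: "g_sab m g z = Some s" using z by blast
    then have "s \<in> {Star, Dagger}" "z \<in> sabotaged m g s"
      by (auto simp: g_sab_def split: if_splits)
    then obtain x y where xy: "x \<in> strict_preimage g False" "y \<in> strict_preimage g True"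
      "\<forall>i<m. z ! i \<noteq> s \<longrightarrow> z ! i = Bit (x ! i) \<and> z ! i = Bit (y ! i)"
      by (auto simp: sabotaged_def)
    have "run (sabotage_tree T) z = s \<and> num_queries (sabotage_tree T) z \<le> separation_time T x y"
      if "T \<in> set_pmf A" for T
      using A[OF that] xy \<open>s \<in> {Star, Dagger}\<close>
      by (intro sabotage_tree_correct[of m]) (auto simp: computes_def)
    with s xy show ?thesis by blast
  qed
  have "zero_error m (g_sab m g) B"
    using sab A by (fastforce simp: zero_error_def B_def computes_def intro: valid_sabotage_tree)
  then have "RS m g \<le> (SUP z \<in> Map.dom (g_sab m g). \<integral>\<^sup>+T. of_nat (num_queries T z) \<partial>measure_pmf B)"
    unfolding RS_def R0_def by (intro INF_lower) auto
  also have "\<dots> \<le> (SUP (x, y) \<in> strict_preimage g False \<times> strict_preimage g True.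
      \<integral>\<^sup>+T. of_nat (separation_time T x y) \<partial>measure_pmf A)"
  proof (rule SUP_least)
    fix z assume "z \<in> Map.dom (g_sab m g)"
    then obtain x y where xy: "x \<in> strict_preimage g False" "y \<in> strict_preimage g True"
      "\<And>T. T \<in> set_pmf A \<Longrightarrow> num_queries (sabotage_tree T) z \<le> separation_time T x y"
      using sab by blast
    have "(\<integral>\<^sup>+T. of_nat (num_queries T z) \<partial>measure_pmf B)
        = (\<integral>\<^sup>+T. of_nat (num_queries (sabotage_tree T) z) \<partial>measure_pmf A)"
      by (simp add: B_def)
    also have "\<dots> \<le> (\<integral>\<^sup>+T. of_nat (separation_time T x y) \<partial>measure_pmf A)"
      using xy(3) by (intro nn_integral_mono_AE) (auto simp: AE_measure_pmf_iff)
    also have "\<dots> \<le> (SUP (x, y) \<in> strict_preimage g False \<times> strict_preimage g True.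
      \<integral>\<^sup>+T. of_nat (separation_time T x y) \<partial>measure_pmf A)"
      using xy(1,2) by (intro SUP_upper2[of "(x, y)"]) auto
    finally show "(\<integral>\<^sup>+T. of_nat (num_queries T z) \<partial>measure_pmf B) \<le> \<dots>" .
  qed
  finally show ?thesis .
qed

text \<open>Without a pair of inputs there is no sabotaged string, and a supremum over the empty
  domain is 0. This secures the nonempty index set for the minimax argument.\<close>

lemma RS_eq_0:
  assumes "strict_preimage g False \<times> strict_preimage g True = {}"
  shows "RS m g = 0"
proof -
  have dom: "Map.dom (g_sab m g) = {}"
    using assms by (auto simp: g_sab_def sabotaged_def split: if_splits)
  then have "zero_error m (g_sab m g) (return_pmf (Leaf Star))"
    by (simp add: zero_error_def)
  then have "RS m g \<le> (SUP z \<in> Map.dom (g_sab m g).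
      \<integral>\<^sup>+T. of_nat (num_queries T z) \<partial>measure_pmf (return_pmf (Leaf Star)))"
    unfolding RS_def R0_def by (intro INF_lower) auto
  then show ?thesis using dom by (simp add: bot_ennreal)
qed

theorem theorem4:
  fixes m :: nat and g :: "(bool list \<times> bool) set"
  assumes "g \<subseteq> {x. length x = m} \<times> UNIV"
  shows "max_conflict m g \<ge> RS m g"
proof (rule ccontr)
  assume "\<not> max_conflict m g \<ge> RS m g"
  then have less: "max_conflict m g < RS m g" by simp
  define I where "I = strict_preimage g False \<times> strict_preimage g True"
  have "I \<subseteq> {x. length x = m} \<times> {x. length x = m}"
    using assms by (auto simp: I_def strict_preimage_def)
  moreover have "finite {x :: bool list. length x = m}"
    using finite_lists_length_eq[of "UNIV :: bool set" m] by simp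
  ultimately have fin: "finite I" by (meson finite_SigmaI finite_subset)
  have ne: "I \<noteq> {}" using less RS_eq_0[of g m] by (auto simp: I_def)
  \<comment> \<open>Two intermediate values are taken because \<open>minimax_weights\<close> loses
    an arbitrarily small amount: the hypothesis is met at \<open>W\<close>, the conclusion is
    obtained at \<open>U\<close>.\<close>
  obtain U where U: "max_conflict m g < U" "U < RS m g" using dense[OF less] by blast
  obtain W where W: "U < W" "W < RS m g" using dense[OF U(2)] by blast
  have fins: "U < top" "W < top" using U W by (auto intro: less_trans less_le_trans)
  define V' V where "V' = enn2real U" and "V = enn2real W"
  have V: "ennreal V' = U" "ennreal V = W" using fins by (auto simp: V'_def V_def)
  have "V' < V" using W(1) V unfolding V_def V'_def
    by (metis enn2real_nonneg ennreal_less_iff)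
  have "\<exists>q. (\<forall>i\<in>I. 0 \<le> q i) \<and> sum q I = 1 \<and>
      (\<forall>T\<in>{T. computes m T g}. V' \<le> (\<Sum>i\<in>I. q i * real (separation_time T (fst i) (snd i))))"
  proof (rule minimax_weights[OF fin ne _ _ \<open>V' < V\<close>])
    fix A :: "(bool, bool) dtree pmf" assume "set_pmf A \<subseteq> {T. computes m T g}"
    \<comment> \<open>Strictness matters: a value strictly below the supremum is exceeded at a
      single pair.\<close>
    then have "W < (SUP (x, y) \<in> I. \<integral>\<^sup>+T. of_nat (separation_time T x y) \<partial>measure_pmf A)"
      unfolding I_def using W(2) RS_le_separation[of A m g] by (auto intro: less_le_trans)
    then show "\<exists>i\<in>I. ennreal V \<le> (\<integral>\<^sup>+T. ennreal (real (separation_time T (fst i) (snd i))) \<partial>measure_pmf A)"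
      unfolding less_SUP_iff V by (force simp: ennreal_of_nat_eq_real_of_nat)
  qed auto
  then obtain q where "\<And>i. i \<in> I \<Longrightarrow> 0 \<le> q i" "sum q I = 1"
    "\<And>T. computes m T g \<Longrightarrow> V' \<le> (\<Sum>(x, y)\<in>I. q (x, y) * real (separation_time T x y))"
    by (auto simp: case_prod_beta)
  then have "ennreal V' \<le> max_conflict m g"
    by (intro max_conflict_ge_weighted_separation[OF assms I_def fin])
  then show False using V U by simp
qed

end
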